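(* Complete intersection monomial curves in $\mathbb{A}^4$ may have arbitrarily large Markov complexity: for every $d\in\mathbb{N}$ there exists a monomial curve $\mathcal{A}=(a_1,a_2,a_3,a_4)$ in $\mathbb{A}^4$ which is a complete intersection and whose Markov complexity satisfies $m(\mathcal{A})>d$.
   Context: A monomial curve in $\mathbb{A}^n$ is given by $n$ distinct positive integers $\mathcal{A}=(a_1,\dots,a_n)$, regarded as a $1\times n$ integer matrix $A$. Its toric ideal $I_{\mathcal{A}}\subset \Bbbk[x_1,\dots,x_n]$ ($\Bbbk$ a field) is generated by all binomials $x^{u}-x^{w}$ with $u,w\in\mathbb{N}^n$ and $u-w\in\ker_{\mathbb{Z}}(A)$; it has height $n-1$. The monomial curve is a complete intersection if $I_{\mathcal{A}}$ can be generated by $n-1$ elements. For an integer matrix $M$ with $N$ columns and nonnegative entries such that $\ker_{\mathbb{Z}}(M)\cap\mathbb{N}^N=\{0\}$ (here $0\in\mathbb{N}$), a Markov basis of $M$ is a finite subset $\mathcal{M}\subset\ker_{\mathbb{Z}}(M)$ such that for all $w,u\in\mathbb{N}^N$ with $w-u\in\ker_{\mathbb{Z}}(M)$ there is a finite sequence $v_1,\dots,v_s$ of elements which up to sign belong to $\mathcal{M}$ (repetitions allowed), with $w-u=\sum_{i=1}^s v_i$ and $w-\sum_{i=1}^p v_i\in\mathbb{N}^N$ for all $1\le p\le s$. A Markov basis is minimal if no proper subset of it is a Markov basis. The universal Markov basis of $M$ is the union of all minimal Markov bases of $M$, where elements differing by a sign are identified. For $r\ge 2$ the $r$-th Lawrence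 lifting $A^{(r)}$ of an $m\times n$ matrix $A$ is the $(rm+n)\times rn$ matrix whose first $rm$ rows form the block diagonal matrix with $r$ diagonal blocks equal to $A$, and whose last $n$ rows are $(I_n\ I_n\ \cdots\ I_n)$. An element of $\ker_{\mathbb{Z}}(A^{(r)})$ is identified with an $r\times n$ integer matrix each of whose rows lies in $\ker_{\mathbb{Z}}(A)$ and whose rows sum to zero. The type of such an element is the number of its nonzero rows. The Markov complexity $m(\mathcal{A})$ is the largest type of any element of the universal Markov basis of $A^{(r)}$, as $r\ge2$ varies. *)

theory Defs
  imports
    "Jordan_Normal_Form.Matrix_Kernel"
    "HOL-Algebra.Ideal"
    "HOL-Library.Poly_Mapping"
    "HOL-Library.Extended_Nat"
begin

section \<open>Toric ideals\<close>

text \<open>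
  A monomial is an exponent function of type \<open>nat \<Rightarrow>\<^sub>0 nat\<close>; the variables
  $x_1,\dots,x_n$ have the indices \<open>0, \<dots>, n - 1\<close>.  The type
  \<open>(nat \<Rightarrow>\<^sub>0 nat) \<Rightarrow>\<^sub>0 'k\<close> has infinitely many variables, and
  \<open>poly_ring n\<close> is its subring $k[x_1,\dots,x_n]$.
\<close>

type_synonym 'k mpoly = "(nat \<Rightarrow>\<^sub>0 nat) \<Rightarrow>\<^sub>0 'k"

definition exponents :: "nat \<Rightarrow> (nat \<Rightarrow>\<^sub>0 nat) set" where
  "exponents n = {u. Poly_Mapping.keys u \<subseteq> {..<n}}"

definition poly_ring :: "nat \<Rightarrow> ('k::field) mpoly ring" where
  "poly_ring n =
     \<lparr>carrier = {p. Poly_Mapping.keys p \<subseteq> exponents n}, mult = (*), one = 1, zero = 0, add = (+)\<rparr>"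

definition exponent_vec :: "nat \<Rightarrow> (nat \<Rightarrow>\<^sub>0 nat) \<Rightarrow> int vec" where
  "exponent_vec n u = vec n (\<lambda>i. int (Poly_Mapping.lookup u i))"

definition toric_ideal :: "int mat \<Rightarrow> ('k::field) mpoly set" where
  "toric_ideal A =
     (let n = dim_col A in
      Idl\<^bsub>poly_ring n\<^esub> {Poly_Mapping.single u 1 - Poly_Mapping.single w 1 | u w.
        u \<in> exponents n \<and> w \<in> exponents n \<and>
        exponent_vec n u - exponent_vec n w \<in> mat_kernel A})"

text \<open>
  \<open>Idl\<close> is an intersection over the ideals of its ring, so it is meaningful only for
  an actual ring.
\<close>

lemma exponents_add: "u \<in> exponents n \<Longrightarrow> w \<in> exponents n \<Longrightarrow> u + w \<in> exponents n"
  using Poly_Mapping.keys_add[of u w] by (auto simp: exponents_def)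

lemma cring_poly_ring: "cring (poly_ring n :: ('k::field) mpoly ring)"
proof (rule cringI)
  show "abelian_group (poly_ring n :: 'k mpoly ring)"
  proof (rule abelian_groupI)
    fix p q :: "'k mpoly"
    assume "p \<in> carrier (poly_ring n)" "q \<in> carrier (poly_ring n)"
    then show "p \<oplus>\<^bsub>poly_ring n\<^esub> q \<in> carrier (poly_ring n)"
      using Poly_Mapping.keys_add[of p q] by (auto simp: poly_ring_def)
  next
    fix p :: "'k mpoly"
    assume "p \<in> carrier (poly_ring n)"
    then show "\<exists>q\<in>carrier (poly_ring n). q \<oplus>\<^bsub>poly_ring n\<^esub> p = \<zero>\<^bsub>poly_ring n\<^esub>"
      by (intro bexI[of _ "- p"]) (auto simp: poly_ring_def)
  qed (auto simp: poly_ring_def algebra_simps)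
  show "Group.comm_monoid (poly_ring n :: 'k mpoly ring)"
  proof (rule comm_monoidI)
    fix p q :: "'k mpoly"
    assume "p \<in> carrier (poly_ring n)" "q \<in> carrier (poly_ring n)"
    then show "p \<otimes>\<^bsub>poly_ring n\<^esub> q \<in> carrier (poly_ring n)"
      using Poly_Mapping.keys_mult[of p q] by (fastforce simp: poly_ring_def intro: exponents_add)
  qed (auto simp: poly_ring_def algebra_simps exponents_def)
qed (auto simp: poly_ring_def algebra_simps)


section \<open>Monomial curves\<close>

definition monomial_curve :: "nat \<Rightarrow> nat list \<Rightarrow> bool" where
  "monomial_curve n a \<longleftrightarrow> length a = n \<and> distinct a \<and> (\<forall>x\<in>set a. 0 < x)"

definition curve_mat :: "nat list \<Rightarrow> int mat" where
  "curve_mat a = mat 1 (length a) (\<lambda>(i, j). int (a ! j))"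

definition complete_intersection :: "'k::field itself \<Rightarrow> nat list \<Rightarrow> bool" where
  "complete_intersection _ a \<longleftrightarrow>
     (let n = length a in
      \<exists>G \<subseteq> carrier (poly_ring n :: 'k mpoly ring).
        finite G \<and> card G = n - 1 \<and> toric_ideal (curve_mat a) = Idl\<^bsub>poly_ring n\<^esub> G)"


section \<open>Markov bases\<close>

definition nonneg_vecs :: "nat \<Rightarrow> int vec set" where
  "nonneg_vecs N = {v \<in> carrier_vec N. 0\<^sub>v N \<le> v}"

text \<open>
  Markov bases are only considered for nonnegative matrices \<open>M\<close> with
  \<open>mat_kernel M \<inter> nonneg_vecs (dim_col M) = {0\<^sub>v (dim_col M)}\<close>.
\<close>

definition markov_basis :: "int mat \<Rightarrow> int vec set \<Rightarrow> bool" where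
  "markov_basis M B \<longleftrightarrow>
     (let N = dim_col M in
      finite B \<and> B \<subseteq> mat_kernel M \<and>
      (\<forall>w \<in> nonneg_vecs N. \<forall>u \<in> nonneg_vecs N. w - u \<in> mat_kernel M \<longrightarrow>
        (\<exists>(s::nat) v.
          (\<forall>i\<in>{1..s}. v i \<in> B \<or> - v i \<in> B) \<and>
          w - u = finsum_vec TYPE(int) N v {1..s} \<and>
          (\<forall>p\<in>{1..s}. w - finsum_vec TYPE(int) N v {1..p} \<in> nonneg_vecs N))))"

definition minimal_markov_basis :: "int mat \<Rightarrow> int vec set \<Rightarrow> bool" where
  "minimal_markov_basis M B \<longleftrightarrow> markov_basis M B \<and> (\<forall>B'. B' \<subset> B \<longrightarrow> \<not> markov_basis M B')"

text \<open>
  Replacing an element of a minimal Markov basis by its negative gives a minimal Markov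
  basis again, so this union contains both signs of each element.  The identification of
  \<open>v\<close> with \<open>- v\<close> is not carried out: the type of an element, the only thing read off
  below, does not depend on the sign.
\<close>

definition universal_markov_basis :: "int mat \<Rightarrow> int vec set" where
  "universal_markov_basis M = \<Union> {B. minimal_markov_basis M B}"


section \<open>Lawrence liftings and Markov complexity\<close>

definition lawrence_lifting :: "nat \<Rightarrow> int mat \<Rightarrow> int mat" where
  "lawrence_lifting r A =
     (let n = dim_col A in
      diag_block_mat (replicate r A) @\<^sub>r mat n (r * n) (\<lambda>(i, j). if j mod n = i then 1 else 0))"

definition as_rows :: "nat \<Rightarrow> nat \<Rightarrow> int vec \<Rightarrow> int mat" where
  "as_rows r n v = mat r n (\<lambda>(i, j). v $ (i * n + j))"

definition lawrence_type :: "nat \<Rightarrow> nat \<Rightarrow> int vec \<Rightarrow> nat" where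
  "lawrence_type r n v = card {i. i < r \<and> row (as_rows r n v) i \<noteq> 0\<^sub>v n}"

text \<open>
  The largest type is taken as a supremum in \<open>enat\<close>; it is the maximum whenever the
  types are bounded.
\<close>

definition markov_complexity :: "nat list \<Rightarrow> enat" where
  "markov_complexity a =
     (SUP (r, v) \<in> {(r, v). 2 \<le> r \<and> v \<in> universal_markov_basis (lawrence_lifting r (curve_mat a))}.
        enat (lawrence_type r (length a) v))"

end

theory Submission
  imports Defs
begin

text \<open>
  For \<open>k \<ge> 1\<close> and \<open>n = k + 2\<close> consider the curve \<open>(1, n, n\<^sup>2 - n, n\<^sup>2 - 1)\<close>.  It is a complete
  intersection because its first entry is 1: every monomial is congruent to the power of
  the first variable of the same weight modulo the binomials \<open>x\<^sub>i - x\<^sub>0 ^ (a ! i)\<close> with \<open>i > 0\<close>, so these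
  three binomials generate the toric ideal (\<open>complete_intersection_if_hd_1\<close>).

  Its Markov complexity is at least \<open>n\<close>.  Identify the nonnegative vectors on which
  the \<open>n\<close>-th Lawrence lifting acts with \<open>n \<times> 4\<close> tables.  Two tables have the same image
  if their rows have the same weights and their columns have the same sums.  Compare the tables

    \<^item> with \<open>k\<close> rows \<open>(1, 0, 0, 1)\<close>, then \<open>(0, 0, n + 1, 0)\<close> and \<open>(0, k, 0, 2)\<close>,
    \<^item> with \<open>k\<close> rows \<open>(0, 1, 1, 0)\<close>, then \<open>(0, 0, 0, n)\<close> and \<open>(k, 0, 3, 0)\<close>.

  The column sums are \<open>(k, k, n + 1, n)\<close>.  As \<open>k < n\<close>, they leave only the two displayed
  possibilities for each of the first \<open>k\<close> rows, whose weight is \<open>n\<^sup>2\<close>.  Reducing the weight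
  \<open>n (n\<^sup>2 - 1)\<close> of the next row modulo \<open>n\<close> and modulo \<open>n - 1\<close> leaves only the two displayed
  possibilities for it as well, because its first two entries sum to at most \<open>k\<close>, and each of them exhausts one column
  sum and thereby decides all other rows.  So there is no third table in this fiber
  (\<open>fiber_of_pos_table\<close>).  A path from one table to the other must therefore be a
  single jump, and the difference of the two tables belongs, up to sign, to every Markov
  basis (\<open>markov_basis_meets_two_element_fiber\<close>).  None of its \<open>n\<close> rows vanishes.

  The universal Markov basis is a union over minimal Markov bases, so it remains to know that there is
  one.  Dickson's lemma yields finitely many nonzero kernel
  elements such that each nonzero kernel element has one of them below it in the conformal
  order, and these form a Markov basis (\<open>ex_markov_basis\<close>); a minimal one is contained in it.
\<close>

section \<open>Existence of minimal Markov bases\<close>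

text \<open>
  Dickson's lemma for a family of \<open>nat\<close>-valued functions.  Let \<open>B\<close> dominate \<open>S\<close> from below in
  the coordinates of \<open>I\<close>, and let \<open>m\<close> bound the new coordinate on \<open>B\<close>.  Then \<open>B\<close> still
  works for the elements of \<open>S\<close> whose new coordinate is at least \<open>m\<close>; the other elements lie
  in finitely many slices on which that coordinate is constant.
\<close>

lemma dickson:
  fixes f :: "'i \<Rightarrow> 'a \<Rightarrow> nat"
  assumes "finite I"
  shows "\<exists>B\<subseteq>S. finite B \<and> (\<forall>s\<in>S. \<exists>b\<in>B. \<forall>i\<in>I. f i b \<le> f i s)"
  using assms
proof (induction I arbitrary: S rule: finite_induct)
  case empty
  show ?case
  proof (cases "S = {}")
    case False
    then obtain s where "s \<in> S" by blast
    then show ?thesis by (intro exI[of _ "{s}"]) auto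
  qed auto
next
  case (insert i I)
  obtain B where B: "B \<subseteq> S" "finite B" "\<forall>s\<in>S. \<exists>b\<in>B. \<forall>i\<in>I. f i b \<le> f i s"
    using insert.IH[of S] by blast
  define m where "m = (\<Sum>b\<in>B. f i b)"
  have le_m: "f i b \<le> m" if "b \<in> B" for b
    unfolding m_def using that B(2) by (simp add: member_le_sum)
  have "\<forall>l. \<exists>C\<subseteq>{s\<in>S. f i s = l}. finite C \<and>
      (\<forall>s\<in>{s\<in>S. f i s = l}. \<exists>b\<in>C. \<forall>i\<in>I. f i b \<le> f i s)"
    by (intro allI insert.IH)
  from choice[OF this] obtain C where C: "\<forall>l. C l \<subseteq> {s\<in>S. f i s = l} \<and> finite (C l) \<and>
      (\<forall>s\<in>{s\<in>S. f i s = l}. \<exists>b\<in>C l. \<forall>i\<in>I. f i b \<le> f i s)" ..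
  have "\<exists>b\<in>B \<union> (\<Union>l<m. C l). \<forall>j\<in>insert i I. f j b \<le> f j s" if s: "s \<in> S" for s
  proof (cases "f i s < m")
    case True
    obtain b where b: "b \<in> C (f i s)" "\<forall>j\<in>I. f j b \<le> f j s"
      using C[rule_format, of "f i s"] s by auto
    have "f i b = f i s" using b(1) C[rule_format, of "f i s"] by auto
    then show ?thesis using b True by (intro bexI[of _ b]) auto
  next
    case False
    obtain b where b: "b \<in> B" "\<forall>j\<in>I. f j b \<le> f j s" using B(3) s by blast
    have "f i b \<le> f i s" using le_m[OF b(1)] False by simp
    then show ?thesis using b by (intro bexI[of _ b]) auto
  qed
  moreover have "B \<union> (\<Union>l<m. C l) \<subseteq> S" using B(1) C by auto
  moreover have "finite (B \<union> (\<Union>l<m. C l))" using B(2) C by simp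
  ultimately show ?case by (intro exI[of _ "B \<union> (\<Union>l<m. C l)"]) simp
qed

lemma finsum_vec_eq_vec:
  assumes "\<And>i. i \<in> {1..p::nat} \<Longrightarrow> v i \<in> carrier_vec N"
  shows "finsum_vec TYPE(int) N v {1..p} = vec N (\<lambda>j. \<Sum>i=1..p. v i $ j)"
proof (rule eq_vecI)
  have v: "v \<in> {1..p} \<rightarrow> carrier_vec N" using assms by blast
  show "dim_vec (finsum_vec TYPE(int) N v {1..p}) = dim_vec (vec N (\<lambda>j. \<Sum>i=1..p. v i $ j))"
    using finsum_vec_closed[OF v] by simp
  fix j assume "j < dim_vec (vec N (\<lambda>j. \<Sum>i=1..p. v i $ j))"
  then show "finsum_vec TYPE(int) N v {1..p} $ j = vec N (\<lambda>j. \<Sum>i=1..p. v i $ j) $ j"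
    using index_finsum_vec[OF _ _ v, of j] by simp
qed

lemma diff_eq_zero_vec_iff:
  fixes u w :: "int vec"
  assumes "u \<in> carrier_vec N" "w \<in> carrier_vec N"
  shows "u - w = 0\<^sub>v N \<longleftrightarrow> u = w"
  using assms by (auto simp: vec_eq_iff)

lemma mat_kernel_carrier: "v \<in> mat_kernel M \<Longrightarrow> v \<in> carrier_vec (dim_col M)"
  by (simp add: mat_kernel_def)

lemma mat_kernel_diff:
  fixes M :: "int mat"
  assumes "v \<in> mat_kernel M" "w \<in> mat_kernel M"
  shows "v - w \<in> mat_kernel M"
  using assms mult_minus_distrib_mat_vec[of M "dim_row M" "dim_col M" v w]
  by (auto simp: mat_kernel_def)

lemma mat_kernel_uminus:
  fixes M :: "int mat"
  assumes "- v \<in> mat_kernel M"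
  shows "v \<in> mat_kernel M"
proof -
  have c: "v \<in> carrier_vec (dim_col M)" using mat_kernel_carrier[OF assms] by simp
  have "0\<^sub>v (dim_col M) \<in> mat_kernel M" by (auto simp: mat_kernel_def)
  from mat_kernel_diff[OF this assms] have "0\<^sub>v (dim_col M) - - v \<in> mat_kernel M" .
  moreover have "0\<^sub>v (dim_col M) - - v = v" using c by (intro eq_vecI) auto
  ultimately show ?thesis by simp
qed

definition markov_path :: "nat \<Rightarrow> int vec set \<Rightarrow> int vec \<Rightarrow> int vec \<Rightarrow> bool" where
  "markov_path N B w u \<longleftrightarrow> (\<exists>(s::nat) v.
          (\<forall>i\<in>{1..s}. v i \<in> B \<or> - v i \<in> B) \<and>
          w - u = finsum_vec TYPE(int) N v {1..s} \<and>
          (\<forall>p\<in>{1..s}. w - finsum_vec TYPE(int) N v {1..p} \<in> nonneg_vecs N))"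

lemma markov_basis_iff_path:
  "markov_basis M B \<longleftrightarrow> finite B \<and> B \<subseteq> mat_kernel M \<and>
    (\<forall>w \<in> nonneg_vecs (dim_col M). \<forall>u \<in> nonneg_vecs (dim_col M).
      w - u \<in> mat_kernel M \<longrightarrow> markov_path (dim_col M) B w u)"
  by (simp add: markov_basis_def markov_path_def Let_def)

lemma nonneg_vecs_iff: "v \<in> nonneg_vecs N \<longleftrightarrow> dim_vec v = N \<and> (\<forall>i<N. 0 \<le> v $ i)"
proof -
  have "v \<in> nonneg_vecs N \<longleftrightarrow> dim_vec v = N \<and> N = dim_vec v \<and> (\<forall>i<dim_vec v. 0\<^sub>v N $ i \<le> v $ i)"
    unfolding nonneg_vecs_def less_eq_vec_def carrier_vec_def index_zero_vec(2) by blast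
  then show ?thesis by (metis index_zero_vec(1))
qed

lemma markov_path_refl:
  assumes "w \<in> carrier_vec N"
  shows "markov_path N B w w"
  unfolding markov_path_def
  using assms by (intro exI[of _ "0::nat"] exI[of _ "\<lambda>_. 0\<^sub>v N"]) (auto simp: finsum_vec_empty)

lemma markov_path_step:
  assumes path: "markov_path N B w (u + b)" and b: "b \<in> B" and B: "B \<subseteq> carrier_vec N"
    and u: "u \<in> nonneg_vecs N" and w: "w \<in> carrier_vec N"
  shows "markov_path N B w u"
proof -
  obtain s :: nat and v where v: "\<forall>i\<in>{1..s}. v i \<in> B \<or> - v i \<in> B"
    and total: "w - (u + b) = finsum_vec TYPE(int) N v {1..s}"
    and nonneg: "\<forall>p\<in>{1..s}. w - finsum_vec TYPE(int) N v {1..p} \<in> nonneg_vecs N"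
    using path unfolding markov_path_def by blast
  have b_carrier: "b \<in> carrier_vec N" and u_carrier: "u \<in> carrier_vec N"
    using b B u by (auto simp: nonneg_vecs_def)
  have carrier: "v i \<in> carrier_vec N" if "i \<in> {1..s}" for i
    using bspec[OF v that] B by auto
  define v' where "v' = v(Suc s := b)"
  have v': "v' i \<in> B \<or> - v' i \<in> B" if "i \<in> {1..Suc s}" for i
    using v b that by (auto simp: v'_def le_Suc_eq)
  have carrier': "v' i \<in> carrier_vec N" if "i \<in> {1..Suc s}" for i
    using carrier b_carrier that by (auto simp: v'_def le_Suc_eq)
  have prefix: "finsum_vec TYPE(int) N v' {1..p} = finsum_vec TYPE(int) N v {1..p}" if "p \<le> s" for p
  proof -
    have "(\<Sum>i=1..p. v' i $ j) = (\<Sum>i=1..p. v i $ j)" for j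
      using that by (intro sum.cong) (auto simp: v'_def)
    then show ?thesis
      using that carrier carrier' by (subst (1 2) finsum_vec_eq_vec) auto
  qed
  have last: "finsum_vec TYPE(int) N v' {1..Suc s} = w - u"
  proof -
    have "finsum_vec TYPE(int) N v' {1..Suc s} = finsum_vec TYPE(int) N v' {1..s} + b"
      using carrier carrier' b_carrier
      by (subst (1 2) finsum_vec_eq_vec) (auto simp: v'_def)
    also have "\<dots> = (w - (u + b)) + b" by (simp add: prefix[unfolded One_nat_def] total[unfolded One_nat_def])
    also have "\<dots> = w - u" using b_carrier u_carrier w by (intro eq_vecI) auto
    finally show ?thesis .
  qed
  have "w - (w - u) = u" using u_carrier w by (intro eq_vecI) auto
  then have "w - finsum_vec TYPE(int) N v' {1..p} \<in> nonneg_vecs N" if "p \<in> {1..Suc s}" for p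
    using that nonneg u last prefix[of p] by (cases "p = Suc s") (auto simp del: One_nat_def)
  then have "\<forall>p\<in>{1..Suc s}. w - finsum_vec TYPE(int) N v' {1..p} \<in> nonneg_vecs N" by blast
  then show ?thesis
    unfolding markov_path_def using v' last[symmetric]
    by (intro exI[of _ "Suc s"] exI[of _ v'] conjI ballI) blast+
qed

text \<open>
  The coordinates to which Dickson's lemma is applied are the positive and the negative parts of the
  entries, so the domination that it yields is the conformal order: \<open>b\<close> lies between 0 and
  \<open>w - u\<close> in each entry.  Hence \<open>u + b\<close> is nonnegative and closer to \<open>w\<close> than \<open>u\<close>
  is, and a path from \<open>w\<close> to \<open>u + b\<close> continues to \<open>u\<close>.
\<close>

lemma ex_markov_basis: "\<exists>B. markov_basis M B"
proof -
  define N where "N = dim_col M"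
  define f where "f = (\<lambda>(i, positive) (v::int vec). if positive then nat (v $ i) else nat (- (v $ i)))"
  obtain B where B: "B \<subseteq> mat_kernel M - {0\<^sub>v N}" "finite B"
    and below: "\<forall>v\<in>mat_kernel M - {0\<^sub>v N}. \<exists>b\<in>B. \<forall>i\<in>{..<N} \<times> UNIV. f i b \<le> f i v"
  proof -
    have "finite ({..<N} \<times> (UNIV :: bool set))" by simp
    from dickson[OF this, of "mat_kernel M - {0\<^sub>v N}" f] that show ?thesis by blast
  qed
  have B_carrier: "B \<subseteq> carrier_vec N" using B(1) by (auto simp: N_def dest: mat_kernel_carrier)
  have path: "markov_path N B w u"
    if w: "w \<in> nonneg_vecs N" and u: "u \<in> nonneg_vecs N" and "w - u \<in> mat_kernel M" for w u
    using u that(3)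
  proof (induction "\<Sum>i<N. nat \<bar>w $ i - u $ i\<bar>" arbitrary: u rule: less_induct)
    case less
    note u = less.prems(1)
    have carrier: "w \<in> carrier_vec N" "u \<in> carrier_vec N" using w u by (auto simp: nonneg_vecs_def)
    show ?case
    proof (cases "w - u = 0\<^sub>v N")
      case True
      then have "w = u" using carrier by (simp add: diff_eq_zero_vec_iff)
      then show ?thesis using markov_path_refl carrier by blast
    next
      case False
      then obtain b where b: "b \<in> B" and le: "\<forall>i\<in>{..<N} \<times> UNIV. f i b \<le> f i (w - u)"
        using below[rule_format, of "w - u"] less.prems(2) by blast
      have bc: "b \<in> carrier_vec N" using b B_carrier by blast
      have conformal: "(0 \<le> b $ i \<and> b $ i \<le> w $ i - u $ i) \<or> (w $ i - u $ i \<le> b $ i \<and> b $ i \<le> 0)"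
        if "i < N" for i
      proof -
        have "nat (b $ i) \<le> nat ((w - u) $ i)" using bspec[OF le, of "(i, True)"] that by (simp add: f_def)
        moreover have "nat (- (b $ i)) \<le> nat (- ((w - u) $ i))"
          using bspec[OF le, of "(i, False)"] that unfolding f_def by simp
        moreover have "(w - u) $ i = w $ i - u $ i" using that carrier by simp
        ultimately show ?thesis by linarith
      qed
      have u': "u + b \<in> nonneg_vecs N"
        unfolding nonneg_vecs_iff
      proof (intro conjI allI impI)
        fix i assume i: "i < N"
        then have "0 \<le> u $ i" "0 \<le> w $ i" using u w by (auto simp: nonneg_vecs_iff)
        then show "0 \<le> (u + b) $ i" using conformal[OF i] bc i by auto
      qed (use bc in simp)
      obtain i where i: "i < N" "b $ i \<noteq> 0"
      proof -
        have "b \<noteq> 0\<^sub>v N" using b B(1) by blast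
        moreover have "dim_vec b = N" using bc by simp
        ultimately obtain i where "i < N" "b $ i \<noteq> 0" by (auto simp: vec_eq_iff)
        then show ?thesis by (rule that)
      qed
      have "(\<Sum>i<N. nat \<bar>w $ i - (u + b) $ i\<bar>) < (\<Sum>i<N. nat \<bar>w $ i - u $ i\<bar>)"
      proof (rule sum_strict_mono_ex1)
        show "\<forall>x\<in>{..<N}. nat \<bar>w $ x - (u + b) $ x\<bar> \<le> nat \<bar>w $ x - u $ x\<bar>"
        proof
          fix x assume "x \<in> {..<N}"
          then have "x < N" "(u + b) $ x = u $ x + b $ x" using bc by auto
          then show "nat \<bar>w $ x - (u + b) $ x\<bar> \<le> nat \<bar>w $ x - u $ x\<bar>"
            using conformal[of x] by linarith
        qed
        show "\<exists>x\<in>{..<N}. nat \<bar>w $ x - (u + b) $ x\<bar> < nat \<bar>w $ x - u $ x\<bar>"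
        proof (rule bexI[of _ i])
          have "(u + b) $ i = u $ i + b $ i" using bc i(1) by simp
          then show "nat \<bar>w $ i - (u + b) $ i\<bar> < nat \<bar>w $ i - u $ i\<bar>"
            using conformal[OF i(1)] i(2) by linarith
        qed (use i in simp)
      qed simp
      moreover have "w - (u + b) \<in> mat_kernel M"
      proof -
        have "(w - u) - b \<in> mat_kernel M"
          by (rule mat_kernel_diff[OF less.prems(2)]) (use b B(1) in blast)
        moreover have "(w - u) - b = w - (u + b)" using bc carrier by (intro eq_vecI) auto
        ultimately show ?thesis by simp
      qed
      ultimately have "markov_path N B w (u + b)" using less.hyps u' by blast
      then show ?thesis by (rule markov_path_step[OF _ b B_carrier u carrier(1)])
    qed
  qed
  then have "markov_basis M B" using B unfolding markov_basis_iff_path N_def by blast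
  then show ?thesis by blast
qed

lemma ex_minimal_markov_basis: "\<exists>B. minimal_markov_basis M B"
proof -
  obtain B where B: "markov_basis M B" using ex_markov_basis by blast
  then have "finite B" by (simp add: markov_basis_iff_path)
  then show ?thesis using B
  proof (induction B rule: finite_psubset_induct)
    case (psubset B)
    then show ?case unfolding minimal_markov_basis_def by blast
  qed
qed

section \<open>Fibers with two elements\<close>

text \<open>
  A path stays in the fiber of \<open>u\<close>, so its first nonzero step leads from \<open>u\<close>
  to the only other element.
\<close>

lemma markov_basis_meets_two_element_fiber:
  assumes B: "markov_basis M B"
    and u: "u \<in> nonneg_vecs (dim_col M)" and w: "w \<in> nonneg_vecs (dim_col M)"
    and diff: "u - w \<in> mat_kernel M" and "u \<noteq> w"
    and fiber: "\<And>x. x \<in> nonneg_vecs (dim_col M) \<Longrightarrow> u - x \<in> mat_kernel M \<Longrightarrow> x = u \<or> x = w"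
  shows "u - w \<in> B \<or> w - u \<in> B"
proof -
  define N where "N = dim_col M"
  note B' = B[unfolded markov_basis_iff_path, folded N_def]
  have carrier: "u \<in> carrier_vec N" "w \<in> carrier_vec N" using u w by (auto simp: nonneg_vecs_def N_def)
  have "markov_path N B u w" using B' u w diff unfolding N_def by blast
  then obtain s :: nat and v where v: "\<forall>i\<in>{1..s}. v i \<in> B \<or> - v i \<in> B"
    and total: "u - w = finsum_vec TYPE(int) N v {1..s}"
    and nonneg: "\<forall>p\<in>{1..s}. u - finsum_vec TYPE(int) N v {1..p} \<in> nonneg_vecs N"
    unfolding markov_path_def by blast
  have ker: "v i \<in> mat_kernel M" if "i \<in> {1..s}" for i
    using v B' that mat_kernel_uminus by blast
  then have vc: "v i \<in> carrier_vec N" if "i \<in> {1..s}" for i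
    using that mat_kernel_carrier unfolding N_def by blast
  have step: "finsum_vec TYPE(int) N v {1..Suc p} = finsum_vec TYPE(int) N v {1..p} + v (Suc p)"
    if "Suc p \<le> s" for p
  proof -
    have dim: "dim_vec (v (Suc p)) = N" using vc[of "Suc p"] that by simp
    show ?thesis
      using that vc by (subst (1 2) finsum_vec_eq_vec) (simp_all add: vec_eq_iff dim)
  qed
  have "\<exists>i\<in>{1..s}. v i = u - w"
  proof (rule ccontr)
    assume none: "\<not> ?thesis"
    have "finsum_vec TYPE(int) N v {1..p} = 0\<^sub>v N" if "p \<le> s" for p
      using that
    proof (induction p)
      case 0
      then show ?case by (simp add: finsum_vec_empty)
    next
      case (Suc p)
      have "Suc p \<in> {1..s}" using Suc.prems by simp
      note here = ker[OF this] vc[OF this] this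
      have eq: "finsum_vec TYPE(int) N v {1..Suc p} = v (Suc p)"
        using step[OF Suc.prems] Suc here(2) by simp
      have "u - v (Suc p) \<in> nonneg_vecs N" using bspec[OF nonneg here(3)] eq by simp
      moreover have "u - (u - v (Suc p)) = v (Suc p)" using carrier here(2) by (intro eq_vecI) auto
      ultimately have "u - v (Suc p) = u \<or> u - v (Suc p) = w"
        using fiber[of "u - v (Suc p)"] here(1) by (simp add: N_def)
      moreover have "u - v (Suc p) \<noteq> w"
        using none here(3) \<open>u - (u - v (Suc p)) = v (Suc p)\<close> by auto
      ultimately have "u - v (Suc p) = u" by blast
      then have "v (Suc p) = u - u" using \<open>u - (u - v (Suc p)) = v (Suc p)\<close> by simp
      then show ?case using eq carrier by simp
    qed
    then have "u - w = 0\<^sub>v N" using total by simp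
    then show False using \<open>u \<noteq> w\<close> carrier by (simp add: diff_eq_zero_vec_iff)
  qed
  then obtain i where i: "i \<in> {1..s}" "v i = u - w" by blast
  have "- (u - w) = w - u" using carrier by (intro eq_vecI) auto
  then show ?thesis using v i by metis
qed

section \<open>The kernel of a Lawrence lifting\<close>

lemma dim_diag_block_replicate:
  "dim_row (diag_block_mat (replicate r A)) = r * dim_row A"
  "dim_col (diag_block_mat (replicate r A)) = r * dim_col A"
  by (simp_all add: dim_diag_block_mat sum_list_replicate)

lemma diag_block_curve_mat_index:
  assumes "i < r" "j < r * length a"
  shows "diag_block_mat (replicate r (curve_mat a)) $$ (i, j)
    = (if j div length a = i then int (a ! (j mod length a)) else 0)"
  using assms
proof (induction r arbitrary: i j)
  case (Suc r)
  let ?D = "diag_block_mat (replicate r (curve_mat a))"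
  have dims: "dim_row ?D = r" "dim_col ?D = r * length a"
    "dim_row (curve_mat a) = 1" "dim_col (curve_mat a) = length a"
    by (simp_all add: dim_diag_block_replicate curve_mat_def)
  have pos: "0 < length a" using Suc.prems(2) by (cases "length a") auto
  show ?case
  proof (cases "j < length a")
    case True
    then show ?thesis
      using Suc.prems by (simp add: Let_def dims) (simp add: curve_mat_def)
  next
    case False
    then have j: "j div length a = Suc ((j - length a) div length a)"
      "j mod length a = (j - length a) mod length a"
      using pos by (simp_all add: le_div_geq le_mod_geq)
    show ?thesis
    proof (cases i)
      case 0
      then show ?thesis using False Suc.prems by (simp add: Let_def dims j)
    next
      case (Suc i')
      have "j - length a < r * length a" "i' < r" using Suc.prems Suc False by auto
      then show ?thesis
        using False Suc.prems Suc.IH[of i' "j - length a"] Suc by (simp add: Let_def dims j)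
    qed
  qed
qed simp

lemma sum_lt_mult_rows:
  fixes f :: "nat \<Rightarrow> int"
  shows "(\<Sum>l<r * n. f l) = (\<Sum>i<r. \<Sum>j<n. f (i * n + j))"
proof -
  have "(\<Sum>j<n. f (i * n + j)) = sum f {i * n..<i * n + n}" for i
    using sum.shift_bounds_nat_ivl[of f 0 "i * n" n]
    by (simp add: atLeast0LessThan add.commute)
  then show ?thesis by (simp add: sum.nat_group)
qed

lemma dim_col_lawrence_lifting: "dim_col (lawrence_lifting r (curve_mat a)) = r * length a"
  by (simp add: lawrence_lifting_def Let_def append_rows_def dim_diag_block_replicate curve_mat_def)

lemma mem_kernel_lawrence_lifting_iff:
  assumes v: "v \<in> carrier_vec (r * length a)"
  shows "v \<in> mat_kernel (lawrence_lifting r (curve_mat a)) \<longleftrightarrow>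
    (\<forall>i<r. (\<Sum>j<length a. int (a ! j) * v $ (i * length a + j)) = 0) \<and>
    (\<forall>j<length a. (\<Sum>i<r. v $ (i * length a + j)) = 0)"
proof -
  let ?n = "length a"
  let ?D = "diag_block_mat (replicate r (curve_mat a))"
  let ?E = "mat ?n (r * ?n) (\<lambda>(i, j). if j mod ?n = i then 1 else (0::int))"
  have D: "?D \<in> carrier_mat r (r * ?n)"
    by (intro carrier_matI) (simp_all add: dim_diag_block_replicate curve_mat_def)
  have E: "?E \<in> carrier_mat ?n (r * ?n)" by simp
  have L: "lawrence_lifting r (curve_mat a) = ?D @\<^sub>r ?E"
    by (simp add: lawrence_lifting_def Let_def curve_mat_def)
  have index: "i * ?n + j < r * ?n" if "i < r" "j < ?n" for i j
  proof -
    have "i * ?n + j < Suc i * ?n" using that by simp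
    also have "\<dots> \<le> r * ?n" using that by (intro mult_le_mono1) simp
    finally show ?thesis .
  qed
  have div: "(i * ?n + j) div ?n = i" if "j < ?n" for i j
    using that by (subst div_mult_self3) auto
  have "v \<in> mat_kernel (lawrence_lifting r (curve_mat a)) \<longleftrightarrow> (?D @\<^sub>r ?E) *\<^sub>v v = 0\<^sub>v (r + ?n)"
    unfolding L using D E v by (simp add: mat_kernel[OF carrier_append_rows[OF D E]])
  also have "\<dots> \<longleftrightarrow> ?D *\<^sub>v v @\<^sub>v ?E *\<^sub>v v = 0\<^sub>v r @\<^sub>v 0\<^sub>v ?n"
  proof -
    have "0\<^sub>v (r + ?n) = 0\<^sub>v r @\<^sub>v (0\<^sub>v ?n :: int vec)" by (auto simp: vec_eq_iff append_vec_def)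
    then show ?thesis by (simp add: mat_mult_append[OF D E v])
  qed
  also have "\<dots> \<longleftrightarrow> ?D *\<^sub>v v = 0\<^sub>v r \<and> ?E *\<^sub>v v = 0\<^sub>v ?n"
    by (rule append_vec_eq[of _ r]) (simp_all add: mult_mat_vec_carrier[OF D v])
  also have "?D *\<^sub>v v = 0\<^sub>v r \<longleftrightarrow> (\<forall>i<r. (\<Sum>j<?n. int (a ! j) * v $ (i * ?n + j)) = 0)"
  proof -
    have "(?D *\<^sub>v v) $ i = (\<Sum>j<?n. int (a ! j) * v $ (i * ?n + j))" if i: "i < r" for i
    proof -
      have "(?D *\<^sub>v v) $ i = (\<Sum>l<r * ?n. ?D $$ (i, l) * v $ l)"
        using D v i by (simp add: scalar_prod_def atLeast0LessThan)
      also have "\<dots> = (\<Sum>i'<r. \<Sum>j<?n. ?D $$ (i, i' * ?n + j) * v $ (i' * ?n + j))"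
        by (rule sum_lt_mult_rows)
      also have "\<dots> = (\<Sum>i'<r. if i' = i then \<Sum>j<?n. int (a ! j) * v $ (i * ?n + j) else 0)"
        by (intro sum.cong refl) (auto simp: diag_block_curve_mat_index[OF i index] div intro!: sum.cong sum.neutral)
      also have "\<dots> = (\<Sum>j<?n. int (a ! j) * v $ (i * ?n + j))" using i by simp
      finally show ?thesis .
    qed
    then show ?thesis using D by (auto simp: vec_eq_iff)
  qed
  also have "?E *\<^sub>v v = 0\<^sub>v ?n \<longleftrightarrow> (\<forall>j<?n. (\<Sum>i<r. v $ (i * ?n + j)) = 0)"
  proof -
    have "(?E *\<^sub>v v) $ j = (\<Sum>i<r. v $ (i * ?n + j))" if j: "j < ?n" for j
    proof -
      have "(?E *\<^sub>v v) $ j = (\<Sum>l<r * ?n. (if l mod ?n = j then 1 else 0) * v $ l)"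
        using v j by (simp add: scalar_prod_def atLeast0LessThan)
      also have "\<dots> = (\<Sum>i<r. \<Sum>j'<?n. (if (i * ?n + j') mod ?n = j then 1 else 0) * v $ (i * ?n + j'))"
        by (rule sum_lt_mult_rows)
      also have "\<dots> = (\<Sum>i<r. \<Sum>j'<?n. if j' = j then v $ (i * ?n + j) else 0)"
        by (intro sum.cong refl) auto
      also have "\<dots> = (\<Sum>i<r. v $ (i * ?n + j))" using j by simp
      finally show ?thesis .
    qed
    then show ?thesis by (simp add: vec_eq_iff)
  qed
  finally show ?thesis .
qed

section \<open>Two linear equations with few solutions\<close>

text \<open>
  The possible entries of a row of weight \<open>n\<^sup>2\<close> on the curve
  \<open>(1, n, n\<^sup>2 - n, n\<^sup>2 - 1)\<close>.  The bounds on \<open>p\<close> and \<open>q\<close> exclude the solutions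
  \<open>(n, 0, 1, 0)\<close> and \<open>(n\<^sup>2 - i n, i, 0, 0)\<close>.
\<close>

lemma row_of_value_square:
  fixes n p q s t :: int
  assumes "3 \<le> n" "0 \<le> p" "p < n" "0 \<le> q" "q < n" "0 \<le> s" "0 \<le> t"
    and eq: "p + n * q + (n^2 - n) * s + (n^2 - 1) * t = n^2"
  shows "(p = 1 \<and> q = 0 \<and> s = 0 \<and> t = 1) \<or> (p = 0 \<and> q = 1 \<and> s = 1 \<and> t = 0)"
proof -
  have sq: "3 * n \<le> n^2" using assms(1) by (simp add: power2_eq_square mult_right_mono)
  have nn: "0 \<le> n * q" "0 \<le> (n^2 - n) * s" "0 \<le> (n^2 - 1) * t"
    using assms sq by (auto intro!: mult_nonneg_nonneg)
  have eq': "n * q + p + ((n^2 - n) * s + (n^2 - 1) * t) = n^2" using eq by simp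
  have t_le: "(n^2 - 1) * t \<le> n^2" and s_le: "(n^2 - n) * s \<le> n^2"
    using eq' nn assms(2) by auto
  have "t < 2"
  proof (rule ccontr)
    assume "\<not> t < 2"
    then have "(n^2 - 1) * 2 \<le> (n^2 - 1) * t" using sq assms(1) by (intro mult_left_mono) auto
    then have "(n^2 - 1) * 2 \<le> n^2" using t_le by (rule order_trans)
    then show False using sq assms(1) by simp
  qed
  have "s < 2"
  proof (rule ccontr)
    assume "\<not> s < 2"
    then have "(n^2 - n) * 2 \<le> (n^2 - n) * s" using sq assms(1) by (intro mult_left_mono) auto
    then have "(n^2 - n) * 2 \<le> n^2" using s_le by (rule order_trans)
    then show False using sq assms(1) by simp
  qed
  consider "t = 1" | "t = 0" "s = 1" | "t = 0" "s = 0"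
    using \<open>t < 2\<close> \<open>s < 2\<close> assms by linarith
  then show ?thesis
  proof cases
    case 1
    then have sum: "p + n * q + (n^2 - n) * s = 1" using eq by simp
    have "s = 0"
    proof (rule ccontr)
      assume "s \<noteq> 0"
      then have "s = 1" using \<open>s < 2\<close> assms by linarith
      then show False using sum nn sq assms by simp
    qed
    moreover have "q = 0"
    proof (rule ccontr)
      assume "q \<noteq> 0"
      then have "n * 1 \<le> n * q" using assms by (intro mult_left_mono) auto
      then show False using sum nn assms by linarith
    qed
    ultimately show ?thesis using sum 1 by simp
  next
    case 2
    then have sum: "p + n * q = n" using eq by simp
    have "q < 2"
    proof (rule ccontr)
      assume "\<not> q < 2"
      then have "n * 2 \<le> n * q" using assms by (intro mult_left_mono) auto
      then show False using sum assms by linarith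
    qed
    then have "q = 0 \<or> q = 1" using assms by linarith
    then show ?thesis using sum 2 assms by auto
  next
    case 3
    have "n * q \<le> n * (n - 1)" using assms by (intro mult_left_mono) auto
    then show ?thesis using eq 3 assms by (simp add: power2_eq_square algebra_simps)
  qed
qed

text \<open>
  Modulo \<open>n\<close> the equation says that \<open>t\<close> and \<open>p\<close> are congruent, so that \<open>t = p\<close> or \<open>t = p + n\<close>.  In the
  first case division by \<open>n\<close> shows that \<open>n - 1\<close> divides \<open>p + q\<close>, which is
  too small unless it vanishes.  In the second case \<open>t = n\<close> already accounts for the whole weight.
\<close>

lemma row_of_value_cubic:
  fixes n p q s t :: int
  assumes "2 \<le> n" "0 \<le> p" "0 \<le> q" "p + q \<le> n - 2" "0 \<le> s" "0 \<le> t" "t \<le> n"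
    and eq: "p + n * q + (n^2 - n) * s + (n^2 - 1) * t = n * (n^2 - 1)"
  shows "p = 0 \<and> q = 0 \<and> ((s = n + 1 \<and> t = 0) \<or> (s = 0 \<and> t = n))"
proof -
  have "p - t = n * (n^2 - 1 - q - (n - 1) * s - n * t)"
    using eq by (simp add: algebra_simps power2_eq_square)
  then have "n dvd p - t" by (metis dvd_triv_left)
  then obtain c where c: "p - t = n * c" by blast
  have "p - t < n" "- n \<le> p - t" using assms by linarith+
  then have "n * c < n * 1" "n * (- 1) \<le> n * c" unfolding c[symmetric] by simp_all
  then have "c < 1" "- 1 \<le> c" using assms(1) by (simp_all only: mult_less_cancel_left_pos mult_le_cancel_left_pos)
  then consider "c = 0" | "c = - 1" by linarith
  then show ?thesis
  proof cases
    case 1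
    then have t: "t = p" using c by simp
    have "n * (n * p + q + (n - 1) * s) = n * (n^2 - 1)"
      using eq t by (simp add: algebra_simps power2_eq_square)
    then have sum: "n * p + q + (n - 1) * s = n^2 - 1" using assms(1) by simp
    then have "p + q = (n - 1) * (n + 1 - p - s)" by (simp add: algebra_simps power2_eq_square)
    then have "n - 1 dvd p + q" by (metis dvd_triv_left)
    then have "p + q = 0" using assms zdvd_imp_le[of "n - 1" "p + q"] by linarith
    then have "p = 0" "q = 0" using assms by linarith+
    then have "(n - 1) * s = (n - 1) * (n + 1)" using sum by (simp add: algebra_simps power2_eq_square)
    then have "s = n + 1" using assms(1) by simp
    then show ?thesis using t \<open>p = 0\<close> \<open>q = 0\<close> by simp
  next
    case 2
    then have "p - t = - n" using c by simp
    then have "t = n" using assms(2,7) by linarith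
    then have "p = 0" using \<open>p - t = - n\<close> by simp
    have "n * q + (n^2 - n) * s = 0" using eq \<open>t = n\<close> \<open>p = 0\<close> by (simp add: algebra_simps)
    moreover have "0 \<le> n * q" using assms by simp
    moreover have pos: "0 < n^2 - n" using assms(1) by (simp add: power2_eq_square)
    moreover from this have "0 \<le> (n^2 - n) * s" using assms(5) by (intro mult_nonneg_nonneg) auto
    ultimately have "n * q = 0" "(n^2 - n) * s = 0" by linarith+
    then have "q = 0" "s = 0" using pos assms(1) by auto
    then show ?thesis using \<open>t = n\<close> \<open>p = 0\<close> by simp
  qed
qed

section \<open>Curves with first entry 1 are complete intersections\<close>

definition weight :: "nat list \<Rightarrow> (nat \<Rightarrow>\<^sub>0 nat) \<Rightarrow> nat" where
  "weight a u = (\<Sum>i<length a. a ! i * Poly_Mapping.lookup u i)"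

lemma weight_add: "weight a (u + w) = weight a u + weight a w"
  by (simp add: weight_def lookup_add algebra_simps sum.distrib)

lemma weight_single: "i < length a \<Longrightarrow> weight a (Poly_Mapping.single i m) = a ! i * m"
  by (simp add: weight_def lookup_single when_def if_distrib cong: if_cong)

lemma mem_kernel_curve_mat_iff:
  "exponent_vec (length a) u - exponent_vec (length a) w \<in> mat_kernel (curve_mat a)
    \<longleftrightarrow> weight a u = weight a w"
proof -
  let ?v = "exponent_vec (length a) u - exponent_vec (length a) w"
  have "?v \<in> mat_kernel (curve_mat a) \<longleftrightarrow> (\<Sum>i<length a. int (a ! i) * ?v $ i) = 0"
    by (auto simp: mat_kernel_def curve_mat_def exponent_vec_def vec_eq_iff scalar_prod_def
        atLeast0LessThan)
  also have "(\<Sum>i<length a. int (a ! i) * ?v $ i) = int (weight a u) - int (weight a w)"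
    by (simp add: weight_def exponent_vec_def sum_subtractf right_diff_distrib)
  finally show ?thesis by simp
qed

lemma single_in_exponents: "i < n \<Longrightarrow> Poly_Mapping.single i m \<in> exponents n"
  by (simp add: exponents_def)

lemma monomial_in_poly_ring:
  "u \<in> exponents n \<Longrightarrow> Poly_Mapping.single u c \<in> carrier (poly_ring n)"
  by (simp add: poly_ring_def)

lemma poly_ring_ideal_closed:
  assumes "ideal J (poly_ring n :: ('k::field) mpoly ring)"
  shows poly_ring_ideal_add: "p \<in> J \<Longrightarrow> q \<in> J \<Longrightarrow> p + q \<in> J"
    and poly_ring_ideal_diff: "p \<in> J \<Longrightarrow> q \<in> J \<Longrightarrow> p - q \<in> J"
    and poly_ring_ideal_mult: "p \<in> J \<Longrightarrow> f \<in> carrier (poly_ring n) \<Longrightarrow> f * p \<in> J"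
    and poly_ring_ideal_zero: "0 \<in> J"
proof -
  interpret ideal J "poly_ring n :: 'k mpoly ring" by fact
  show add: "p \<in> J \<Longrightarrow> q \<in> J \<Longrightarrow> p + q \<in> J" for p q
    using additive_subgroup.a_closed[OF additive_subgroup_axioms, of p q] by (simp add: poly_ring_def)
  show mult: "p \<in> J \<Longrightarrow> f \<in> carrier (poly_ring n) \<Longrightarrow> f * p \<in> J" for p f
    using I_l_closed[of p f] by (simp add: poly_ring_def)
  show "0 \<in> J" using additive_subgroup.zero_closed[OF additive_subgroup_axioms] by (simp add: poly_ring_def)
  \<comment> \<open>Additive inverses in the ideal come from multiplication by \<open>- 1\<close>.\<close>
  have "(- 1 :: 'k mpoly) \<in> carrier (poly_ring n)"
    by (simp add: poly_ring_def exponents_def)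
  from mult[OF _ this] have "q \<in> J \<Longrightarrow> - q \<in> J" for q by simp
  with add[of p "- q"] show "p \<in> J \<Longrightarrow> q \<in> J \<Longrightarrow> p - q \<in> J" by simp
qed

text \<open>
  One variable \<open>x\<^sub>i\<close> of the monomial is replaced at a time, and what is left has smaller
  weight since the entries of \<open>a\<close> are positive.
\<close>

lemma monomial_reduces_to_first_variable:
  assumes J: "ideal J (poly_ring (length a) :: ('k::field) mpoly ring)"
    and pos: "\<forall>x\<in>set a. 0 < x" and "a \<noteq> []"
    and gens: "\<And>i. i < length a \<Longrightarrow>
      Poly_Mapping.single (Poly_Mapping.single i 1) 1
        - Poly_Mapping.single (Poly_Mapping.single 0 (a ! i)) 1 \<in> J"
    and "u \<in> exponents (length a)"
  shows "Poly_Mapping.single u (1::'k) - Poly_Mapping.single (Poly_Mapping.single 0 (weight a u)) 1 \<in> J"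
  using assms(5)
proof (induction "weight a u" arbitrary: u rule: less_induct)
  case less
  let ?X = "\<lambda>u. Poly_Mapping.single u (1::'k)" and ?x = "\<lambda>m. Poly_Mapping.single (0::nat) (m::nat)"
  show ?case
  proof (cases "u = 0")
    case True
    then show ?thesis using poly_ring_ideal_zero[OF J] by (simp add: weight_def)
  next
    case False
    then obtain i where i: "i \<in> Poly_Mapping.keys u" by fastforce
    then have i': "i < length a" using less.prems by (auto simp: exponents_def)
    define e where "e = Poly_Mapping.single i (1::nat)"
    define u' where "u' = u - e"
    have lookup_i: "0 < Poly_Mapping.lookup u i" using i by (simp add: in_keys_iff)
    have u: "u = e + u'"
      using lookup_i by (intro poly_mapping_eqI)
        (auto simp: u'_def e_def lookup_add lookup_minus lookup_single when_def)
    have "Poly_Mapping.keys u' \<subseteq> Poly_Mapping.keys u"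
      by (auto simp: u'_def in_keys_iff lookup_minus)
    then have u': "u' \<in> exponents (length a)" using less.prems by (auto simp: exponents_def)
    have w: "weight a u = a ! i + weight a u'"
      using i' by (simp add: u weight_add e_def weight_single)
    have "0 < a ! i" using pos i' by simp
    then have IH: "?X u' - ?X (?x (weight a u')) \<in> J" using less.hyps u' w by simp
    have "?X u = ?X e * ?X u'" by (simp add: mult_single u)
    moreover have "?X (?x (weight a u)) = ?X (?x (weight a u')) * ?X (?x (a ! i))"
      by (simp add: mult_single w flip: single_add) (simp add: add.commute)
    ultimately have "?X u - ?X (?x (weight a u))
        = ?X e * (?X u' - ?X (?x (weight a u'))) + ?X (?x (weight a u')) * (?X e - ?X (?x (a ! i)))"
      by (simp add: algebra_simps)
    moreover have "?X e \<in> carrier (poly_ring (length a))"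
      "?X (?x (weight a u')) \<in> carrier (poly_ring (length a))"
      using i' \<open>a \<noteq> []\<close> by (auto simp: e_def intro!: monomial_in_poly_ring single_in_exponents)
    ultimately show ?thesis
      using poly_ring_ideal_mult[OF J] poly_ring_ideal_add[OF J] IH gens[OF i', folded e_def]
      by metis
  qed
qed

text \<open>
  The generators are \<open>x\<^sub>i - x\<^sub>0 ^ (a ! i)\<close> for \<open>0 < i < n\<close>.  Monomials of the same
  weight reduce to the same power of \<open>x\<^sub>0\<close>, so their difference lies in the ideal that these
  generate.
\<close>

lemma complete_intersection_if_hd_1:
  assumes "a \<noteq> []" and a0: "a ! 0 = 1" and pos: "\<forall>x\<in>set a. 0 < x"
  shows "complete_intersection TYPE('k::field) a"
proof -
  define n where "n = length a"
  let ?R = "poly_ring n :: 'k mpoly ring"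
  interpret cring ?R by (rule cring_poly_ring)
  define g where "g i = Poly_Mapping.single (Poly_Mapping.single i 1) (1::'k)
    - Poly_Mapping.single (Poly_Mapping.single 0 (a ! i)) 1" for i
  define G where "G = g ` {1..<n}"
  define S where "S = {Poly_Mapping.single u (1::'k) - Poly_Mapping.single w 1 | u w.
        u \<in> exponents n \<and> w \<in> exponents n \<and> weight a u = weight a w}"
  have toric: "toric_ideal (curve_mat a) = Idl\<^bsub>?R\<^esub> S"
  proof -
    have "dim_col (curve_mat a) = n" by (simp add: curve_mat_def n_def)
    then show ?thesis
      unfolding toric_ideal_def Let_def S_def by (simp add: mem_kernel_curve_mat_iff n_def)
  qed
  have n: "0 < n" using \<open>a \<noteq> []\<close> by (simp add: n_def)
  have S_carrier: "S \<subseteq> carrier ?R"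
  proof
    fix p assume "p \<in> S"
    then obtain u w where p: "p = Poly_Mapping.single u 1 - Poly_Mapping.single w 1"
      and "u \<in> exponents n" "w \<in> exponents n" unfolding S_def by blast
    have "Poly_Mapping.keys p \<subseteq> {u, w}"
      unfolding p using keys_diff[of "Poly_Mapping.single u (1::'k)" "Poly_Mapping.single w 1"] by auto
    then show "p \<in> carrier ?R"
      using \<open>u \<in> exponents n\<close> \<open>w \<in> exponents n\<close> by (auto simp: poly_ring_def)
  qed
  have GS: "G \<subseteq> S"
  proof
    fix p assume "p \<in> G"
    then obtain i where i: "i < n" "p = g i" by (auto simp: G_def)
    have "weight a (Poly_Mapping.single i 1) = weight a (Poly_Mapping.single 0 (a ! i))"
      using i n a0 by (simp add: weight_single n_def)
    then show "p \<in> S"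
      unfolding S_def i(2) g_def using i(1) n by (blast intro: single_in_exponents)
  qed
  have inj: "inj_on g {1..<n}"
  proof (rule inj_onI, rule ccontr)
    fix i j assume ij: "i \<in> {1..<n}" "j \<in> {1..<n}" "g i = g j" "i \<noteq> j"
    have ne: "Poly_Mapping.single l (Suc 0) \<noteq> Poly_Mapping.single m c" if "l \<noteq> m" for l m :: nat and c
      using that by (metis lookup_single_eq lookup_single_not_eq nat.distinct(1))
    have "Poly_Mapping.lookup (g i) (Poly_Mapping.single i 1) = 1"
      using ij(1,2,4) ne[of i 0 "a ! i", symmetric] by (simp add: g_def lookup_minus lookup_single when_def)
    moreover have "Poly_Mapping.lookup (g j) (Poly_Mapping.single i 1) = 0"
      using ij(1,2,4) ne[of i 0 "a ! j", symmetric] ne[of j i "Suc 0"] by (simp add: g_def lookup_minus lookup_single when_def)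
    ultimately show False using ij(3) by simp
  qed
  have ideal: "ideal (Idl\<^bsub>?R\<^esub> G) ?R" using genideal_ideal GS S_carrier by blast
  have gens: "g i \<in> Idl\<^bsub>?R\<^esub> G" if "i < n" for i
  proof (cases "i = 0")
    case True
    then show ?thesis using poly_ring_ideal_zero[OF ideal] a0 by (simp add: g_def)
  next
    case False
    then have "g i \<in> G" using that by (simp add: G_def)
    then show ?thesis using genideal_self[of G] GS S_carrier by blast
  qed
  have "S \<subseteq> Idl\<^bsub>?R\<^esub> G"
  proof
    fix p assume "p \<in> S"
    then obtain u w where p: "p = Poly_Mapping.single u 1 - Poly_Mapping.single w 1"
      and uw: "u \<in> exponents n" "w \<in> exponents n" "weight a u = weight a w" unfolding S_def by blast
    let ?y = "Poly_Mapping.single (Poly_Mapping.single 0 (weight a w)) (1::'k)"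
    note red = monomial_reduces_to_first_variable[OF ideal[unfolded n_def] pos \<open>a \<noteq> []\<close>
        gens[unfolded g_def n_def], folded n_def]
    have "Poly_Mapping.single u 1 - ?y \<in> Idl\<^bsub>?R\<^esub> G" "Poly_Mapping.single w 1 - ?y \<in> Idl\<^bsub>?R\<^esub> G"
      using red[OF _ uw(1)] red[OF _ uw(2)] uw(3) by simp_all
    from poly_ring_ideal_diff[OF ideal this] show "p \<in> Idl\<^bsub>?R\<^esub> G" by (simp add: p)
  qed
  then have "Idl\<^bsub>?R\<^esub> S = Idl\<^bsub>?R\<^esub> G"
    using genideal_minimal[OF ideal] subset_Idl_subset[OF S_carrier] GS genideal_self[OF S_carrier]
      genideal_minimal[OF genideal_ideal[OF S_carrier]] by blast
  moreover have "card G = n - 1" "finite G" using inj by (simp_all add: G_def card_image)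
  moreover have "G \<subseteq> carrier ?R" using GS S_carrier by blast
  ultimately show ?thesis
    unfolding complete_intersection_def Let_def using toric n_def by metis
qed

section \<open>A fiber with two tables and no common row\<close>

text \<open>
  This is \<open>(1, n, n\<^sup>2 - n, n\<^sup>2 - 1)\<close> for \<open>n = k + 2\<close>.  The parameter \<open>k\<close> is the number of
  equal rows in the tables below, and with products the entries need no truncated subtraction.
\<close>

definition witness_curve :: "nat \<Rightarrow> nat list" where
  "witness_curve k = [1, k + 2, (k + 1) * (k + 2), (k + 1) * (k + 3)]"

definition pos_table :: "nat \<Rightarrow> nat \<Rightarrow> nat \<Rightarrow> int" where
  "pos_table k i j = (if i < k then [1, 0, 0, 1] else if i = k then [0, 0, int k + 3, 0]
    else [0, int k, 0, 2]) ! j"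

definition neg_table :: "nat \<Rightarrow> nat \<Rightarrow> nat \<Rightarrow> int" where
  "neg_table k i j = (if i < k then [0, 1, 1, 0] else if i = k then [0, 0, 0, int k + 2]
    else [int k, 0, 3, 0]) ! j"

text \<open>
  Equality of row weights and of column sums: the images of \<open>X\<close> and \<open>Y\<close> under the
  Lawrence lifting \<open>lawrence_lifting (k + 2)\<close> agree.
\<close>

definition same_fiber :: "nat \<Rightarrow> (nat \<Rightarrow> nat \<Rightarrow> int) \<Rightarrow> (nat \<Rightarrow> nat \<Rightarrow> int) \<Rightarrow> bool" where
  "same_fiber k X Y \<longleftrightarrow>
    (\<forall>i<k + 2. (\<Sum>j<4. int (witness_curve k ! j) * (X i j - Y i j)) = 0) \<and>
    (\<forall>j<4. (\<Sum>i<k + 2. X i j - Y i j) = 0)"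

lemma sum_lessThan_4: fixes f :: "nat \<Rightarrow> int" shows "(\<Sum>j<4. f j) = f 0 + f 1 + f 2 + f 3"
  by (simp add: numeral_eq_Suc lessThan_Suc)

lemma all_less_4: "(\<forall>j<4. P j) \<longleftrightarrow> P 0 \<and> P 1 \<and> P 2 \<and> P (3::nat)"
  by (auto simp: numeral_eq_Suc less_Suc_eq)

lemma all_less_add_2: "(\<forall>i<k + 2. P i) \<longleftrightarrow> (\<forall>i<k. P i) \<and> P k \<and> P (k + 1 :: nat)"
  by (auto simp: less_Suc_eq)

lemma sum_lessThan_add_2: fixes f :: "nat \<Rightarrow> int" shows "(\<Sum>i<k + 2. f i) = (\<Sum>i<k. f i) + f k + f (k + 1)"
  by simp

lemma same_fiber_tables: "same_fiber k (pos_table k) (neg_table k)"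
  unfolding same_fiber_def all_less_add_2 all_less_4 sum_lessThan_4 sum_lessThan_add_2
  by (simp add: pos_table_def neg_table_def witness_curve_def algebra_simps)

text \<open>
  The first \<open>k\<close> rows of \<open>X\<close> are \<open>(1, 0, 0, 1)\<close> or \<open>(0, 1, 1, 0)\<close>, so together they use up
  exactly \<open>k\<close> of the total \<open>2 k\<close> of the first two columns.  This bound on
  what is left for row \<open>k\<close> is the hypothesis of \<open>row_of_value_cubic\<close>.  If row \<open>k\<close> is
  \<open>(0, 0, n + 1, 0)\<close>, it exhausts the third column and no earlier row can be \<open>(0, 1, 1, 0)\<close>; if it is
  \<open>(0, 0, 0, n)\<close>, it exhausts the fourth and no earlier row can be \<open>(1, 0, 0, 1)\<close>.  The last
  row is determined by the column sums.
\<close>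

lemma fiber_of_pos_table:
  assumes k: "1 \<le> k" and nonneg: "\<And>i j. i < k + 2 \<Longrightarrow> j < 4 \<Longrightarrow> 0 \<le> X i j"
    and fib: "same_fiber k (pos_table k) X"
  shows "(\<forall>i<k + 2. \<forall>j<4. X i j = pos_table k i j) \<or> (\<forall>i<k + 2. \<forall>j<4. X i j = neg_table k i j)"
proof -
  define n where "n = int k + 2"
  define T where "T j = (\<Sum>i<k. X i j)" for j
  have n: "3 \<le> n" using k by (simp add: n_def)
  have curve: "int (witness_curve k ! 0) = 1" "int (witness_curve k ! 1) = n"
    "int (witness_curve k ! 2) = n^2 - n" "int (witness_curve k ! 3) = n^2 - 1"
    by (simp_all add: witness_curve_def n_def power2_eq_square algebra_simps)
  have row_eq: "X i 0 + n * X i 1 + (n^2 - n) * X i 2 + (n^2 - 1) * X i 3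
      = pos_table k i 0 + n * pos_table k i 1 + (n^2 - n) * pos_table k i 2 + (n^2 - 1) * pos_table k i 3"
    if "i < k + 2" for i
    using fib that unfolding same_fiber_def sum_lessThan_4 curve by (simp add: algebra_simps)
  have "(\<Sum>i<k + 2. X i j) = (\<Sum>i<k + 2. pos_table k i j)" if "j < 4" for j
    using fib that unfolding same_fiber_def sum_subtractf by simp
  then have "T j + X k j + X (k + 1) j = (\<Sum>i<k. pos_table k i j) + pos_table k k j + pos_table k (k + 1) j"
    if "j < 4" for j
    using that unfolding T_def sum_lessThan_add_2 by blast
  from this[of 0] this[of 1] this[of 2] this[of 3]
  have col: "T 0 + X k 0 + X (k + 1) 0 = int k" "T 1 + X k 1 + X (k + 1) 1 = int k"
    "T 2 + X k 2 + X (k + 1) 2 = n + 1" "T 3 + X k 3 + X (k + 1) 3 = n"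
    by (simp_all add: pos_table_def n_def)
  have X_le_T: "X i j \<le> T j" if "i < k" "j < 4" for i j
    unfolding T_def using that nonneg by (intro member_le_sum) auto
  have T_nonneg: "0 \<le> T j" if "j < 4" for j
    unfolding T_def using that nonneg by (intro sum_nonneg) auto
  note ge0 = nonneg[of k 0] nonneg[of k 1] nonneg[of k 2] nonneg[of k 3]
    nonneg[of "k + 1" 0] nonneg[of "k + 1" 1] nonneg[of "k + 1" 2] nonneg[of "k + 1" 3]
  have first_rows: "(X i 0 = 1 \<and> X i 1 = 0 \<and> X i 2 = 0 \<and> X i 3 = 1) \<or>
      (X i 0 = 0 \<and> X i 1 = 1 \<and> X i 2 = 1 \<and> X i 3 = 0)" if i: "i < k" for i
  proof (rule row_of_value_square)
    show "3 \<le> n" by fact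
    show "X i 0 < n" "X i 1 < n" using X_le_T[OF i, of 0] X_le_T[OF i, of 1] col ge0 by (simp_all add: n_def)
    show "X i 0 + n * X i 1 + (n^2 - n) * X i 2 + (n^2 - 1) * X i 3 = n^2"
      using row_eq[of i] i by (simp add: pos_table_def)
  qed (use i nonneg in auto)
  \<comment> \<open>Both possible rows have exactly one 1 in the first two columns.\<close>
  have "T 0 + T 1 = (\<Sum>i<k. 1)"
    unfolding T_def sum.distrib[symmetric] by (intro sum.cong refl) (use first_rows in fastforce)
  then have "X k 0 + X k 1 \<le> n - 2" using col ge0 by (simp add: n_def)
  moreover have "X k 0 + n * X k 1 + (n^2 - n) * X k 2 + (n^2 - 1) * X k 3 = n * (n^2 - 1)"
    using row_eq[of k] by (simp add: pos_table_def n_def power2_eq_square algebra_simps)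
  moreover have "X k 3 \<le> n" using col(4) ge0 T_nonneg[of 3] by simp
  ultimately have "X k 0 = 0 \<and> X k 1 = 0 \<and> ((X k 2 = n + 1 \<and> X k 3 = 0) \<or> (X k 2 = 0 \<and> X k 3 = n))"
    using n ge0 by (intro row_of_value_cubic) auto
  then consider (A) "X k 0 = 0" "X k 1 = 0" "X k 2 = n + 1" "X k 3 = 0"
    | (B) "X k 0 = 0" "X k 1 = 0" "X k 2 = 0" "X k 3 = n" by blast
  then show ?thesis
  proof cases
    case A
    then have "T 2 = 0" using col ge0 T_nonneg[of 2] by simp
    then have rows: "X i 0 = 1" "X i 1 = 0" "X i 2 = 0" "X i 3 = 1" if "i < k" for i
      using first_rows[OF that] X_le_T[OF that, of 2] by auto
    then have "T 0 = int k" "T 1 = 0" "T 2 = 0" "T 3 = int k" by (simp_all add: T_def)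
    then show ?thesis using A rows col
      by (intro disjI1) (simp add: all_less_add_2[simplified] all_less_4 pos_table_def n_def)
  next
    case B
    then have "T 3 = 0" using col ge0 T_nonneg[of 3] by simp
    then have rows: "X i 0 = 0" "X i 1 = 1" "X i 2 = 1" "X i 3 = 0" if "i < k" for i
      using first_rows[OF that] X_le_T[OF that, of 3] by auto
    then have "T 0 = 0" "T 1 = int k" "T 2 = int k" "T 3 = 0" by (simp_all add: T_def)
    then show ?thesis using B rows col
      by (intro disjI2) (simp add: all_less_add_2[simplified] all_less_4 neg_table_def n_def)
  qed
qed

text \<open>
  The rows are concatenated, which is the inverse of \<open>as_rows\<close> for tables with 4 columns.
\<close>

definition table_vec :: "nat \<Rightarrow> (nat \<Rightarrow> nat \<Rightarrow> int) \<Rightarrow> int vec" where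
  "table_vec r X = vec (r * 4) (\<lambda>l. X (l div 4) (l mod 4))"

lemma table_vec_index: "i < r \<Longrightarrow> j < 4 \<Longrightarrow> table_vec r X $ (i * 4 + j) = X i j"
  by (simp add: table_vec_def)

lemma eq_table_vecI:
  assumes "x \<in> carrier_vec (r * 4)" "\<forall>i<r. \<forall>j<4. x $ (i * 4 + j) = X i j"
  shows "x = table_vec r X"
proof (rule eq_vecI)
  fix l assume "l < dim_vec (table_vec r X)"
  then have l: "l < r * 4" by (simp add: table_vec_def)
  then have "l div 4 < r" by (simp add: less_mult_imp_div_less)
  moreover have "l mod 4 < 4" by simp
  ultimately have "x $ (l div 4 * 4 + l mod 4) = X (l div 4) (l mod 4)"
    using assms(2)[rule_format, of "l div 4" "l mod 4"] by (simp only:)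
  then show "x $ l = table_vec r X $ l" using l by (simp add: table_vec_def)
qed (use assms(1) in \<open>simp add: table_vec_def\<close>)

lemma mem_kernel_iff_same_fiber:
  assumes "x \<in> carrier_vec ((k + 2) * 4)" "y \<in> carrier_vec ((k + 2) * 4)"
  shows "x - y \<in> mat_kernel (lawrence_lifting (k + 2) (curve_mat (witness_curve k))) \<longleftrightarrow>
    same_fiber k (\<lambda>i j. x $ (i * 4 + j)) (\<lambda>i j. y $ (i * 4 + j))"
proof -
  have len: "length (witness_curve k) = 4" by (simp add: witness_curve_def)
  have c: "x - y \<in> carrier_vec ((k + 2) * length (witness_curve k))" using assms by (simp add: len)
  have "(x - y) $ (i * 4 + j) = x $ (i * 4 + j) - y $ (i * 4 + j)" if "i < k + 2" "j < 4" for i j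
    using assms that by (intro index_minus_vec) auto
  then show ?thesis
    unfolding mem_kernel_lawrence_lifting_iff[OF c] len same_fiber_def by simp
qed

lemma same_fiber_cong:
  assumes "\<And>i j. i < k + 2 \<Longrightarrow> j < 4 \<Longrightarrow> X i j = X' i j" "\<And>i j. i < k + 2 \<Longrightarrow> j < 4 \<Longrightarrow> Y i j = Y' i j"
  shows "same_fiber k X Y \<longleftrightarrow> same_fiber k X' Y'"
  using assms by (simp add: same_fiber_def)

section \<open>Unbounded Markov complexity\<close>

lemma full_type_element_in_markov_basis:
  assumes k: "1 \<le> k" and B: "markov_basis (lawrence_lifting (k + 2) (curve_mat (witness_curve k))) B"
  shows "\<exists>v\<in>B. lawrence_type (k + 2) 4 v = k + 2"
proof -
  define M where "M = lawrence_lifting (k + 2) (curve_mat (witness_curve k))"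
  define u where "u = table_vec (k + 2) (pos_table k)"
  define w where "w = table_vec (k + 2) (neg_table k)"
  have len: "length (witness_curve k) = 4" by (simp add: witness_curve_def)
  have dim: "dim_col M = (k + 2) * 4" by (simp only: M_def dim_col_lawrence_lifting len)
  have carrier: "u \<in> carrier_vec ((k + 2) * 4)" "w \<in> carrier_vec ((k + 2) * 4)"
    by (simp_all add: u_def w_def table_vec_def)
  have u_index: "u $ (i * 4 + j) = pos_table k i j" if "i < k + 2" "j < 4" for i j
    unfolding u_def using that by (rule table_vec_index)
  have w_index: "w $ (i * 4 + j) = neg_table k i j" if "i < k + 2" "j < 4" for i j
    unfolding w_def using that by (rule table_vec_index)
  have u_fiber: "same_fiber k (\<lambda>i j. u $ (i * 4 + j)) Y \<longleftrightarrow> same_fiber k (pos_table k) Y" for Y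
    by (rule same_fiber_cong) (simp_all only: u_index)
  have w_fiber: "same_fiber k X (\<lambda>i j. w $ (i * 4 + j)) \<longleftrightarrow> same_fiber k X (neg_table k)" for X
    by (rule same_fiber_cong) (simp_all only: w_index)
  have nth4: "0 \<le> [a, b, c, d] ! j" if "0 \<le> a" "0 \<le> b" "0 \<le> c" "0 \<le> d" "j < 4" for a b c d :: int and j
    using that nth_mem[of j "[a, b, c, d]"] by auto
  have u: "u \<in> nonneg_vecs (dim_col M)" and w: "w \<in> nonneg_vecs (dim_col M)"
    by (auto simp: nonneg_vecs_iff dim u_def w_def table_vec_def pos_table_def neg_table_def intro!: nth4)
  have "u - w \<in> mat_kernel M"
    unfolding M_def mem_kernel_iff_same_fiber[OF carrier] u_fiber w_fiber by (rule same_fiber_tables)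
  moreover have "u \<noteq> w"
    using u_index[of k 2] w_index[of k 2] by (auto simp: pos_table_def neg_table_def)
  moreover have "x = u \<or> x = w" if x: "x \<in> nonneg_vecs (dim_col M)" and ux: "u - x \<in> mat_kernel M" for x
  proof -
    have xc: "x \<in> carrier_vec ((k + 2) * 4)" using x by (simp add: nonneg_vecs_def dim)
    have fib: "same_fiber k (pos_table k) (\<lambda>i j. x $ (i * 4 + j))"
      using ux unfolding M_def mem_kernel_iff_same_fiber[OF carrier(1) xc] u_fiber .
    have "0 \<le> x $ (i * 4 + j)" if "i < k + 2" "j < 4" for i j
      using x that by (simp add: nonneg_vecs_iff dim)
    from fiber_of_pos_table[OF k this fib] show ?thesis
      unfolding u_def w_def using eq_table_vecI[OF xc] by blast
  qed
  ultimately have mem: "u - w \<in> B \<or> w - u \<in> B"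
    using B u w by (intro markov_basis_meets_two_element_fiber[of M]) (auto simp: M_def)
  have type: "lawrence_type (k + 2) 4 v = k + 2"
    if v: "v = u - w \<or> v = w - u" for v
  proof -
    have "row (as_rows (k + 2) 4 v) i \<noteq> 0\<^sub>v 4" if i: "i < k + 2" for i
    proof
      \<comment> \<open>The third column distinguishes the two tables in every row.\<close>
      assume "row (as_rows (k + 2) 4 v) i = 0\<^sub>v 4"
      then have "row (as_rows (k + 2) 4 v) i $ 2 = 0" by simp
      then have "v $ (i * 4 + 2) = 0" using i by (simp add: as_rows_def)
      moreover have "(u - w) $ (i * 4 + 2) = u $ (i * 4 + 2) - w $ (i * 4 + 2)"
        "(w - u) $ (i * 4 + 2) = w $ (i * 4 + 2) - u $ (i * 4 + 2)"
      proof -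
        have "i * 4 + 2 < dim_vec u" "i * 4 + 2 < dim_vec w" using i carrier by simp_all
        then show "(u - w) $ (i * 4 + 2) = u $ (i * 4 + 2) - w $ (i * 4 + 2)"
          "(w - u) $ (i * 4 + 2) = w $ (i * 4 + 2) - u $ (i * 4 + 2)" by simp_all
      qed
      ultimately have "u $ (i * 4 + 2) = w $ (i * 4 + 2)" using v by (metis eq_iff_diff_eq_0)
      moreover have "u $ (i * 4 + 2) = pos_table k i 2" by (rule u_index[OF i]) simp
      moreover have "w $ (i * 4 + 2) = neg_table k i 2" by (rule w_index[OF i]) simp
      ultimately have "pos_table k i 2 = neg_table k i 2" by (simp only:)
      then show False by (simp add: pos_table_def neg_table_def split: if_splits)
    qed
    then have "{i. i < k + 2 \<and> row (as_rows (k + 2) 4 v) i \<noteq> 0\<^sub>v 4} = {..<k + 2}" by auto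
    then show ?thesis unfolding lawrence_type_def by (simp only: card_lessThan)
  qed
  from mem type show ?thesis by blast
qed

lemma markov_complexity_witness_ge:
  assumes "1 \<le> k"
  shows "enat (k + 2) \<le> markov_complexity (witness_curve k)"
proof -
  obtain B where B: "minimal_markov_basis (lawrence_lifting (k + 2) (curve_mat (witness_curve k))) B"
    using ex_minimal_markov_basis by blast
  then obtain v where v: "v \<in> B" "lawrence_type (k + 2) 4 v = k + 2"
    using full_type_element_in_markov_basis[OF assms] unfolding minimal_markov_basis_def by blast
  have "v \<in> universal_markov_basis (lawrence_lifting (k + 2) (curve_mat (witness_curve k)))"
    unfolding universal_markov_basis_def using B v(1) by blast
  moreover have "length (witness_curve k) = 4" by (simp add: witness_curve_def)
  ultimately show ?thesis
    unfolding markov_complexity_def using v(2) by (intro SUP_upper2[of "(k + 2, v)"]) auto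
qed

lemma monomial_curve_witness: "1 \<le> k \<Longrightarrow> monomial_curve 4 (witness_curve k)"
proof -
  assume "1 \<le> k"
  then have "1 < k + 2" "k + 2 < (k + 1) * (k + 2)" "(k + 1) * (k + 2) < (k + 1) * (k + 3)"
    by (simp_all add: algebra_simps)
  then show ?thesis unfolding monomial_curve_def witness_curve_def by auto
qed

theorem corollary4p3:
  fixes d :: nat
  shows "\<exists>a. monomial_curve 4 a \<and> complete_intersection TYPE('k::field) a
               \<and> enat d < markov_complexity a"
proof (intro exI conjI)
  let ?a = "witness_curve (d + 1)"
  show "monomial_curve 4 ?a" by (rule monomial_curve_witness) simp
  show "complete_intersection TYPE('k) ?a"
    by (rule complete_intersection_if_hd_1) (auto simp: witness_curve_def)
  have "enat d < enat (d + 1 + 2)" by simp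
  also have "\<dots> \<le> markov_complexity ?a" by (rule markov_complexity_witness_ge) simp
  finally show "enat d < markov_complexity ?a" .
qed

end
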